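(* There exist a constant $c>0$ and a sequence of real numbers $(\varepsilon_k)_{k\ge 1}$ with $\varepsilon_k\to 0$ as $k\to\infty$ such that for every positive integer $k$ and every positive integer $N$ there exist pairwise coprime positive integers $q_1<q_2<\cdots<q_k$ with $q_1>N$ such that, for $\rho=\{q_1,q_2,\ldots,q_k\}$, $$\left(\frac{A_\rho}{M_\rho}\right)^{2^{-k}} > c+\varepsilon_k .$$ Here $A_\rho$ is the largest absolute value of a coefficient of the inclusion-exclusion polynomial $Q_\rho$, and $M_\rho=\prod_{j=1}^{k-2}q_j^{2^{k-j-1}-1}$.
   Context: Let $q_1<q_2<\cdots<q_k$ be pairwise coprime positive integers, put $\rho=\{q_1,\ldots,q_k\}$ and $m=q_1q_2\cdots q_k$. The inclusion-exclusion polynomial $Q_\rho$ is defined by $$Q_\rho(x)=\frac{(1-x^m)\cdot\prod_{1\le j_1<j_2\le k}\left(1-x^{m/(q_{j_1}q_{j_2})}\right)\cdots}{\prod_{1\le j_1\le k}\left(1-x^{m/q_{j_1}}\right)\cdot\prod_{1\le j_1<j_2<j_3\le k}\left(1-x^{m/(q_{j_1}q_{j_2}q_{j_3})}\right)\cdots},$$ that is, $$Q_\rho(x)=\prod_{S\subseteq\{1,\ldots,k\}}\left(1-x^{m/\prod_{j\in S}q_j}\right)^{(-1)^{|S|}},$$ which is a polynomial with integer coefficients. (When the $q_j$ are distinct primes, $Q_\rho$ is the $m$th cyclotomic polynomial.) The height $A_\rho$ is the maximum of the absolute values of the coefficients of $Q_\rho$. Empty products equal $1$, so $M_\rho=1$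 for $k\le 2$. The sequence $(\varepsilon_k)$ makes explicit the error term $o_k(1)$, a quantity tending to $0$ as $k\to\infty$; it depends only on $k$ and not on $N$. *)

theory Defs
  imports Complex_Main "HOL-Computational_Algebra.Polynomial"
begin

text \<open>
  \<open>Q\<^sub>\<rho>\<close> is the product over all \<open>S \<subseteq> \<rho>\<close> of \<open>1 - x ^ (m / \<Prod>S)\<close>, raised to the power
  \<open>(-1) ^ |S|\<close>: even sets give the numerator, odd sets the denominator. For a finite set
  of pairwise coprime positive integers the denominator is nonzero and divides the numerator
  in the integer polynomials, so \<open>div\<close> is the exact quotient there.
\<close>

definition incl_excl_poly :: "nat set \<Rightarrow> int poly" where
  "incl_excl_poly \<rho> =
     (\<Prod>S\<in>{S. S \<subseteq> \<rho> \<and> even (card S)}. 1 - monom 1 (\<Prod>\<rho> div \<Prod>S)) div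
     (\<Prod>S\<in>{S. S \<subseteq> \<rho> \<and> odd (card S)}. 1 - monom 1 (\<Prod>\<rho> div \<Prod>S))"

definition poly_height :: "int poly \<Rightarrow> int" where
  "poly_height p = Max ((\<lambda>i. \<bar>coeff p i\<bar>) ` {..degree p})"

definition incl_excl_height :: "nat set \<Rightarrow> int" where
  "incl_excl_height \<rho> = poly_height (incl_excl_poly \<rho>)"

text \<open>
  \<open>M\<^sub>\<rho>\<close> for \<open>\<rho> = {q 1 < \<dots> < q k}\<close>. It depends on the order of the elements, hence is stated
  in terms of the enumeration \<open>q\<close>. For \<open>k \<le> 2\<close> the product is empty; for \<open>j \<le> k - 2\<close> no
  subtraction of natural numbers truncates.
\<close>

definition M_rho :: "nat \<Rightarrow> (nat \<Rightarrow> nat) \<Rightarrow> nat" where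
  "M_rho k q = (\<Prod>j=1..k-2. q j ^ (2 ^ (k - j - 1) - 1))"

end

theory Submission
  imports Defs "HOL-Computational_Algebra.Fundamental_Theorem_Algebra" "HOL-Number_Theory.Cong"
    "HOL-Real_Asymp.Real_Asymp"
begin

text \<open>
  The height of \<open>Q\<^sub>\<rho>\<close> is at least its maximum modulus on the unit circle divided by \<open>2m\<close>, and
  \<open>Q\<^sub>\<sigma>(x) = Q\<^sub>\<rho>(x\<^sup>q) / Q\<^sub>\<rho>(x)\<close> for \<open>\<sigma> = \<rho> \<union> {q}\<close>. Write \<open>e(t) = exp(2\<pi>it)\<close> and suppose that
  \<open>|Q\<^sub>\<rho>(e(y))| > X m\<close> and that \<open>e(z/m)\<close> is a root of \<open>Q\<^sub>\<rho>\<close> at which the derivative is at most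
  \<open>m/W\<close> in modulus, where \<open>y\<close> is within \<open>R/m\<close> of \<open>a/m\<close> and \<open>a\<close>, \<open>z\<close> are coprime to \<open>m\<close>. Choose \<open>q\<close> large with \<open>qz \<equiv> a (mod m)\<close>.
  A point at distance about \<open>R/(mq)\<close> from the root \<open>e(z/m)\<close> is mapped to \<open>e(y)\<close> by the \<open>q\<close>-th power, so
  the quotient there exceeds \<open>mq X W/(8R)\<close>. On the other hand some \<open>q\<close>-th root of \<open>e(z/m)\<close> lies close
  to \<open>e(y)\<close>, and there the derivative of the quotient is at most \<open>q/(X W)\<close>. Hence \<open>X\<close> is replaced by
  \<open>X W/(8R)\<close> and \<open>W\<close> by \<open>X W m\<close>, that is, \<open>X\<close> is essentially squared and multiplied by the product of
  the moduli other than the largest two of \<open>\<sigma>\<close>. This is the recursion of \<open>M\<^sub>\<rho>\<close>, up to a factor \<open>8R\<close>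
  growing linearly in the number of steps, which costs a constant to the power \<open>2\<^sup>k\<close>.
\<close>

section \<open>Integer polynomials viewed over the complex numbers\<close>

abbreviation cpoly :: "int poly \<Rightarrow> complex poly" where
  "cpoly \<equiv> map_poly of_int"

lemma cpoly_add: "cpoly (p + q) = cpoly p + cpoly q"
  by (intro poly_eqI) (simp add: coeff_map_poly)

lemma cpoly_mult: "cpoly (p * q) = cpoly p * cpoly q"
  by (intro poly_eqI) (simp add: coeff_map_poly coeff_mult)

lemma cpoly_smult: "cpoly (smult a p) = smult (of_int a) (cpoly p)"
  by (intro poly_eqI) (simp add: coeff_map_poly)

lemma degree_cpoly [simp]: "degree (cpoly p) = degree p"
  by (rule degree_map_poly) auto

lemma cpoly_eq_0_iff [simp]: "cpoly p = 0 \<longleftrightarrow> p = 0"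
  by (rule map_poly_eq_0_iff) auto

lemma cpoly_pcompose_monom: "cpoly (p \<circ>\<^sub>p monom 1 n) = cpoly p \<circ>\<^sub>p monom 1 n"
proof (induction p)
  case (pCons a p)
  have "cpoly (pCons a p) = pCons (of_int a) (cpoly p)" for a and p :: "int poly"
    by (rule map_poly_pCons) auto
  with pCons show ?case
    by (simp add: pcompose_pCons cpoly_add cpoly_mult map_poly_monom)
qed simp

lemma poly_cpoly_pcompose_monom:
  "poly (cpoly (p \<circ>\<^sub>p monom 1 n)) x = poly (cpoly p) (x ^ n)"
  by (simp add: cpoly_pcompose_monom poly_pcompose poly_monom)

lemma pderiv_pcompose_monom:
  fixes p :: "complex poly"
  shows "poly (pderiv (p \<circ>\<^sub>p monom 1 n)) x = of_nat n * x ^ (n - 1) * poly (pderiv p) (x ^ n)"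
  by (simp add: pderiv_pcompose poly_pcompose poly_monom pderiv_monom)

section \<open>Divisibility from common roots\<close>

lemma degree_eq_card_roots:
  fixes p :: "complex poly"
  assumes "rsquarefree p"
  shows "card {x. poly p x = 0} = degree p"
proof -
  have "p \<noteq> 0" using assms by (simp add: rsquarefree_def)
  have "degree (smult (lead_coeff p) (\<Prod>x | poly p x = 0. [:-x, 1:])) = card {x. poly p x = 0}"
    using \<open>p \<noteq> 0\<close> by (simp add: degree_prod_sum_eq)
  then show ?thesis by (simp only: complex_poly_decompose_rsquarefree[OF assms])
qed

text \<open>The pseudo-remainder vanishes at all \<open>degree p\<close> distinct roots of
  \<open>p\<close> but has smaller degree, hence is zero. The leading coefficient being 1 or -1
  makes the scaling factor of pseudo-division a unit, so the quotient stays integral.\<close>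

lemma dvd_if_separable_roots:
  fixes p q :: "int poly"
  assumes lead: "\<bar>lead_coeff p\<bar> = 1"
    and sep: "rsquarefree (cpoly p)"
    and roots: "\<And>x. poly (cpoly p) x = 0 \<Longrightarrow> poly (cpoly q) x = 0"
  shows "p dvd q"
proof -
  have "p \<noteq> 0" using lead by auto
  obtain s r where "pseudo_divmod q p = (s, r)" by fastforce
  from pseudo_divmod[OF \<open>p \<noteq> 0\<close> this]
  have eq: "smult (lead_coeff p ^ (Suc (degree q) - degree p)) q = p * s + r"
    and deg: "r = 0 \<or> degree r < degree p" by auto
  define a where "a = lead_coeff p ^ (Suc (degree q) - degree p)"
  have a: "a * a = 1"
  proof -
    have "lead_coeff p * lead_coeff p = 1" using lead by (metis abs_mult_self_eq mult_1)
    then show ?thesis unfolding a_def by (metis power_mult_distrib power_one)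
  qed
  have "r = 0"
  proof (rule ccontr)
    assume r: "r \<noteq> 0"
    have "cpoly (smult a q) = cpoly p * cpoly s + cpoly r"
      using eq unfolding a_def by (simp only: cpoly_mult cpoly_add)
    then have *: "poly (cpoly r) x = of_int a * poly (cpoly q) x - poly (cpoly p) x * poly (cpoly s) x" for x
      by (metis add_diff_cancel_left' cpoly_smult poly_add poly_mult poly_smult)
    have "{x. poly (cpoly p) x = 0} \<subseteq> {x. poly (cpoly r) x = 0}"
      using roots by (auto simp: *)
    moreover have "finite {x. poly (cpoly r) x = 0}"
      using r by (intro poly_roots_finite) auto
    ultimately have "card {x. poly (cpoly p) x = 0} \<le> card {x. poly (cpoly r) x = 0}"
      by (rule card_mono[rotated])
    also have "\<dots> \<le> degree (cpoly r)"
      using r by (intro card_poly_roots_bound) auto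
    finally have "degree p \<le> degree r"
      using degree_eq_card_roots[OF sep] by simp
    with deg r show False by simp
  qed
  with eq have "smult a q = p * s" by (simp add: a_def)
  then have "q = p * smult a s"
    by (metis a mult_smult_right smult_1_left smult_smult)
  then show ?thesis by (rule dvdI)
qed

section \<open>Numerator and denominator when a modulus is added\<close>

lemma incl_excl_poly_eqI:
  assumes "(\<Prod>S\<in>{S. S \<subseteq> \<rho> \<and> even (card S)}. 1 - monom 1 (\<Prod>\<rho> div \<Prod>S)) =
      Q * (\<Prod>S\<in>{S. S \<subseteq> \<rho> \<and> odd (card S)}. 1 - monom 1 (\<Prod>\<rho> div \<Prod>S))"
    and "(\<Prod>S\<in>{S. S \<subseteq> \<rho> \<and> odd (card S)}. 1 - monom 1 (\<Prod>\<rho> div \<Prod>S)) \<noteq> (0 :: int poly)"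
  shows "incl_excl_poly \<rho> = Q"
  unfolding incl_excl_poly_def assms(1) by (rule nonzero_mult_div_cancel_right[OF assms(2)])

text \<open>The numerator for \<open>True\<close>, the denominator for \<open>False\<close>. The
  Boolean lets one recursion treat both, since adding a modulus mixes the two parities.\<close>

definition sign_factor :: "nat set \<Rightarrow> bool \<Rightarrow> int poly" where
  "sign_factor \<rho> b = (\<Prod>S\<in>{S. S \<subseteq> \<rho> \<and> even (card S) = b}. 1 - monom 1 (\<Prod>\<rho> div \<Prod>S))"

lemma one_minus_monom_neq_0: "n > 0 \<Longrightarrow> 1 - monom 1 n \<noteq> (0 :: int poly)"
proof
  assume "n > 0" "1 - monom 1 n = (0 :: int poly)"
  then have "coeff (1 - monom 1 n) n = (0 :: int)" by simp
  with \<open>n > 0\<close> show False by simp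
qed

lemma monom_one_pcompose: "monom 1 a \<circ>\<^sub>p monom 1 b = monom (1 :: 'a :: comm_semiring_1) (b * a)"
proof (induction a)
  case 0
  show ?case by (simp add: pcompose_1)
next
  case (Suc a)
  then show ?case by (simp add: monom_Suc[of _ a] pcompose_pCons mult_monom)
qed

text \<open>Subsets avoiding \<open>q\<close> keep their parity while the exponent is multiplied by
  \<open>q\<close>, which is the substitution of \<open>x^q\<close>. Putting \<open>q\<close> into a
  subset leaves the exponent as it was for \<open>\<rho>\<close> but flips the parity.\<close>

lemma sign_factor_insert:
  assumes "finite \<rho>" "q \<notin> \<rho>" "\<And>r. r \<in> insert q \<rho> \<Longrightarrow> r > 0"
  shows "sign_factor (insert q \<rho>) b = (sign_factor \<rho> b \<circ>\<^sub>p monom 1 q) * sign_factor \<rho> (\<not> b)"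
proof -
  define f where "f = (\<lambda>S. 1 - monom (1::int) (\<Prod>(insert q \<rho>) div \<Prod>S))"
  have q: "q > 0" using assms by auto
  let ?A = "\<lambda>b. {S. S \<subseteq> \<rho> \<and> even (card S) = b}"
  have fin: "finite (?A b)" for b using assms(1) by simp
  have card: "card (insert q S) = Suc (card S)" if "S \<subseteq> \<rho>" for S
    using that assms(1,2) by (meson card_insert_disjoint finite_subset subsetD)
  have split: "{S. S \<subseteq> insert q \<rho> \<and> even (card S) = b} = ?A b \<union> insert q ` ?A (\<not> b)" (is "?L = ?R")
  proof (intro equalityI subsetI)
    fix S assume S: "S \<in> ?L"
    show "S \<in> ?R"
    proof (cases "q \<in> S")
      case False
      then show ?thesis using S by auto
    next
      case True
      then have "S = insert q (S - {q})" "S - {q} \<subseteq> \<rho>" using S by auto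
      moreover have "even (card (S - {q})) = (\<not> b)"
        using card[OF calculation(2)] calculation(1) S by auto
      ultimately show ?thesis by blast
    qed
  qed (use card in auto)
  have dvd: "\<Prod>S dvd \<Prod>\<rho>" if "S \<subseteq> \<rho>" for S
    using that assms(1) by (rule prod_dvd_prod_subset[rotated])
  have prod: "\<Prod>(insert q S) = q * \<Prod>S" if "S \<subseteq> \<rho>" for S
    using that assms(1,2) by (meson finite_subset prod.insert subsetD)
  have "sign_factor (insert q \<rho>) b = prod f ?L"
    by (simp add: sign_factor_def f_def)
  also have "\<dots> = prod f (?A b) * prod f (insert q ` ?A (\<not> b))"
    unfolding split using fin assms(2) by (intro prod.union_disjoint) auto
  also have "prod f (?A b) = sign_factor \<rho> b \<circ>\<^sub>p monom 1 q"
    unfolding sign_factor_def pcompose_prod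
  proof (rule prod.cong[OF refl])
    fix S assume "S \<in> ?A b"
    then have "S \<subseteq> \<rho>" by auto
    then have "\<Prod>(insert q \<rho>) div \<Prod>S = q * (\<Prod>\<rho> div \<Prod>S)"
      using dvd prod[OF subset_refl] by (simp add: div_mult_swap)
    then show "f S = (1 - monom 1 (\<Prod>\<rho> div \<Prod>S)) \<circ>\<^sub>p monom 1 q"
      by (simp add: f_def pcompose_diff pcompose_1 monom_one_pcompose)
  qed
  also have "prod f (insert q ` ?A (\<not> b)) = prod (f \<circ> insert q) (?A (\<not> b))"
    using assms(2) by (intro prod.reindex) (auto simp: inj_on_def)
  also have "\<dots> = sign_factor \<rho> (\<not> b)"
    unfolding sign_factor_def
  proof (rule prod.cong[OF refl])
    fix S assume "S \<in> ?A (\<not> b)"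
    then have "S \<subseteq> \<rho>" by auto
    then show "(f \<circ> insert q) S = 1 - monom 1 (\<Prod>\<rho> div \<Prod>S)"
      using q by (simp add: f_def prod[OF subset_refl] prod[OF \<open>S \<subseteq> \<rho>\<close>])
  qed
  finally show ?thesis .
qed

lemma sign_factor_neq_0:
  assumes "finite \<rho>" "\<And>r. r \<in> \<rho> \<Longrightarrow> r > 0"
  shows "sign_factor \<rho> b \<noteq> 0"
proof -
  have "\<Prod>\<rho> div \<Prod>S > 0" if "S \<subseteq> \<rho>" for S
  proof -
    have "\<Prod>S dvd \<Prod>\<rho>" using that assms(1) by (rule prod_dvd_prod_subset[rotated])
    moreover have "\<Prod>\<rho> > 0" using assms by (simp add: prod_pos)
    ultimately show ?thesis by (simp add: dvd_div_eq_0_iff div_greater_zero_iff dvd_imp_le dvd_pos_nat)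
  qed
  then show ?thesis
    using assms(1) one_minus_monom_neq_0 by (auto simp: sign_factor_def)
qed

text \<open>
  The closure of the roots under powers coprime to \<open>m\<close> is what makes \<open>Q\<close> divide \<open>Q(x\<^sup>q)\<close>; it replaces
  an explicit description of the roots.
\<close>

definition cyclotomic_like :: "nat \<Rightarrow> int poly \<Rightarrow> bool" where
  "cyclotomic_like m Q \<longleftrightarrow> \<bar>lead_coeff Q\<bar> = 1 \<and> degree Q \<le> m \<and> rsquarefree (cpoly Q) \<and>
     (\<forall>x. poly (cpoly Q) x = 0 \<longrightarrow>
        x ^ m = 1 \<and> (\<forall>n. coprime n m \<longrightarrow> poly (cpoly Q) (x ^ n) = 0))"

text \<open>By the chain rule \<open>Q(x^q)\<close> has only simple roots away from 0, so
  \<open>T\<close> is separable and shares no root with \<open>Q\<close>. Closure under powers then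
  reduces to \<open>x ^ n\<close> not being a root of \<open>Q\<close>.\<close>

lemma cyclotomic_like_quotient:
  assumes Q: "cyclotomic_like m Q" and "m > 0" "q > 0" and cop: "coprime q m"
    and T: "T * Q = Q \<circ>\<^sub>p monom 1 q"
  shows "cyclotomic_like (m * q) T"
proof -
  have lead: "\<bar>lead_coeff Q\<bar> = 1" and deg: "degree Q \<le> m" and sep: "rsquarefree (cpoly Q)"
    and root: "\<And>x. poly (cpoly Q) x = 0 \<Longrightarrow> x ^ m = 1"
    and root': "\<And>x n. poly (cpoly Q) x = 0 \<Longrightarrow> coprime n m \<Longrightarrow> poly (cpoly Q) (x ^ n) = 0"
    using Q by (auto simp: cyclotomic_like_def)
  have Tx: "poly (cpoly T) x * poly (cpoly Q) x = poly (cpoly Q) (x ^ q)" for x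
    by (metis T cpoly_mult poly_cpoly_pcompose_monom poly_mult)
  have "Q \<noteq> 0" using lead by auto
  have lT: "lead_coeff T * lead_coeff Q = lead_coeff Q"
  proof -
    have "lead_coeff (Q \<circ>\<^sub>p monom 1 q) = lead_coeff Q"
      using \<open>q > 0\<close> by (subst lead_coeff_comp) (auto simp: degree_monom_eq)
    then show ?thesis by (metis T lead_coeff_mult)
  qed
  then have 1: "\<bar>lead_coeff T\<bar> = 1" using \<open>Q \<noteq> 0\<close> by simp
  then have "T \<noteq> 0" by auto
  have "degree T + degree Q = q * degree Q"
    by (metis T \<open>Q \<noteq> 0\<close> \<open>T \<noteq> 0\<close> degree_monom_eq degree_mult_eq degree_pcompose mult.commute one_neq_zero)
  then have "degree T \<le> q * degree Q" by simp
  also have "\<dots> \<le> m * q" using deg by (simp add: mult.commute)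
  finally have 2: "degree T \<le> m * q" .
  have rootT: "poly (cpoly Q) (x ^ q) = 0 \<and> poly (cpoly Q) x \<noteq> 0 \<and> poly (pderiv (cpoly T)) x \<noteq> 0"
    if x: "poly (cpoly T) x = 0" for x
  proof -
    have Qq: "poly (cpoly Q) (x ^ q) = 0" using Tx[of x] x by simp
    then have "(x ^ q) ^ m = 1" by (rule root)
    then have "x \<noteq> 0" using \<open>m > 0\<close> \<open>q > 0\<close> by (intro notI) (simp add: power_0_left)
    have "poly (pderiv (cpoly Q)) (x ^ q) \<noteq> 0"
      using sep Qq by (auto simp: rsquarefree_roots)
    then have "poly (pderiv (cpoly Q \<circ>\<^sub>p monom 1 q)) x \<noteq> 0"
      using \<open>x \<noteq> 0\<close> \<open>q > 0\<close> by (simp add: pderiv_pcompose_monom)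
    moreover have "cpoly Q \<circ>\<^sub>p monom 1 q = cpoly T * cpoly Q"
      by (metis T cpoly_mult cpoly_pcompose_monom)
    ultimately show ?thesis using Qq x by (auto simp: pderiv_mult)
  qed
  have 3: "rsquarefree (cpoly T)"
    using rootT by (auto simp: rsquarefree_roots)
  have 4: "x ^ (m * q) = 1" if "poly (cpoly T) x = 0" for x
    using root rootT[OF that] by (metis mult.commute power_mult)
  have 5: "poly (cpoly T) (x ^ n) = 0" if x: "poly (cpoly T) x = 0" and n: "coprime n (m * q)" for x n
  proof -
    have n': "coprime n m" using n by simp
    have "poly (cpoly Q) ((x ^ q) ^ n) = 0"
      using root'[OF _ n'] rootT[OF x] by blast
    then have "poly (cpoly Q) ((x ^ n) ^ q) = 0" by (metis mult.commute power_mult)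
    moreover have "poly (cpoly Q) (x ^ n) \<noteq> 0"
    proof
      assume *: "poly (cpoly Q) (x ^ n) = 0"
      \<comment> \<open>An inverse of \<open>n\<close> modulo \<open>m * q\<close> leads back from
        \<open>x ^ n\<close> to \<open>x\<close>, so closure of the roots of \<open>Q\<close> would
        make \<open>x\<close> one of them.\<close>
      obtain n2 where n2: "[n * n2 = Suc 0] (mod (m * q))"
        using cong_solve_coprime_nat[OF n] by blast
      then have "coprime n2 (m * q)"
        by (metis coprime_iff_invertible_nat mult.commute)
      then have "poly (cpoly Q) ((x ^ n) ^ n2) = 0"
        using root'[OF *] by simp
      moreover have "(x ^ n) ^ n2 = x"
      proof -
        have "(x ^ n) ^ n2 = x ^ (n * n2)" by (simp add: power_mult)
        also obtain u v where uv: "n * n2 + u * (m * q) = 1 + v * (m * q)"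
          using n2 by (metis cong_iff_lin_nat One_nat_def mult.commute)
        have "x ^ (n * n2) = x ^ (n * n2 + u * (m * q))"
          using 4[OF x] by (simp add: power_add power_mult mult.commute[of u])
        also have "\<dots> = x"
          unfolding uv using 4[OF x] by (simp add: power_add power_mult mult.commute[of v])
        finally show ?thesis .
      qed
      ultimately show False using rootT[OF x] by simp
    qed
    ultimately show ?thesis using Tx[of "x ^ n"] by simp
  qed
  from 1 2 3 4 5 show ?thesis by (simp add: cyclotomic_like_def)
qed

section \<open>Root structure and recursion of the inclusion-exclusion polynomials\<close>

lemma incl_excl_poly_empty: "incl_excl_poly {} = [:1, -1:]"
proof -
  have "{S. S = {} \<and> even (card S)} = {{} :: nat set}" "{S. S = {} \<and> odd (card S)} = ({} :: nat set set)"
    by auto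
  then have "incl_excl_poly {} = 1 - monom 1 1"
    unfolding incl_excl_poly_def by (simp only: subset_empty) simp
  then show ?thesis by (simp add: monom_altdef one_pCons)
qed

text \<open>Closure of the roots under \<open>q\<close>-th powers makes \<open>Q\<close> divide
  \<open>Q(x^q)\<close>. The quotient satisfies the fraction identity for
  \<open>insert q \<rho>\<close> exactly, which identifies it with the \<open>div\<close> of the
  definition.\<close>

lemma incl_excl_poly_insert_if:
  assumes "finite \<rho>" "\<And>r. r \<in> insert q \<rho> \<Longrightarrow> r > 0" "q \<notin> \<rho>" "coprime q (\<Prod>\<rho>)"
    and frac: "sign_factor \<rho> True = incl_excl_poly \<rho> * sign_factor \<rho> False"
    and wb: "cyclotomic_like (\<Prod>\<rho>) (incl_excl_poly \<rho>)"
  shows "incl_excl_poly (insert q \<rho>) * incl_excl_poly \<rho> = incl_excl_poly \<rho> \<circ>\<^sub>p monom 1 q"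
    and "sign_factor (insert q \<rho>) True = incl_excl_poly (insert q \<rho>) * sign_factor (insert q \<rho>) False"
proof -
  let ?Q = "incl_excl_poly \<rho>"
  have "?Q dvd ?Q \<circ>\<^sub>p monom 1 q"
    using wb \<open>coprime q (\<Prod>\<rho>)\<close>
    by (intro dvd_if_separable_roots) (auto simp: cyclotomic_like_def poly_cpoly_pcompose_monom)
  then obtain T where T: "?Q \<circ>\<^sub>p monom 1 q = T * ?Q" by (metis dvdE mult.commute)
  have eq: "sign_factor (insert q \<rho>) True = T * sign_factor (insert q \<rho>) False"
    using assms(1-3) by (subst (1 2) sign_factor_insert) (simp_all add: frac pcompose_mult T ac_simps)
  then have "incl_excl_poly (insert q \<rho>) = T"
    using sign_factor_neq_0[of "insert q \<rho>" False] assms(1,2)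
    by (intro incl_excl_poly_eqI) (simp_all add: sign_factor_def)
  then show "incl_excl_poly (insert q \<rho>) * incl_excl_poly \<rho> = incl_excl_poly \<rho> \<circ>\<^sub>p monom 1 q"
    and "sign_factor (insert q \<rho>) True = incl_excl_poly (insert q \<rho>) * sign_factor (insert q \<rho>) False"
    using T eq by simp_all
qed

text \<open>One induction carries both facts: exactness for \<open>insert q \<rho>\<close> rests on
  the root structure for \<open>\<rho>\<close>, and the new root structure comes from the resulting
  quotient identity.\<close>

lemma incl_excl_poly_cyclotomic_like:
  assumes "finite \<rho>" "\<And>r. r \<in> \<rho> \<Longrightarrow> r > 0" "pairwise coprime \<rho>"
  shows "sign_factor \<rho> True = incl_excl_poly \<rho> * sign_factor \<rho> False"
    and "cyclotomic_like (\<Prod>\<rho>) (incl_excl_poly \<rho>)"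
proof -
  have "sign_factor \<rho> True = incl_excl_poly \<rho> * sign_factor \<rho> False \<and>
    cyclotomic_like (\<Prod>\<rho>) (incl_excl_poly \<rho>)"
    using assms
  proof (induction \<rho> rule: finite_induct)
    case empty
    have c: "cpoly [:1, -1:] = [:1, -1:]" by (simp add: map_poly_pCons)
    have "{S. S = {} \<and> even (card S) = b} = (if b then {{}} else {} :: nat set set)" for b
      by auto
    then have "sign_factor {} b = (if b then 1 - monom 1 1 else 1)" for b
      unfolding sign_factor_def by (simp only: subset_empty) simp
    then show ?case
      unfolding cyclotomic_like_def incl_excl_poly_empty c rsquarefree_roots
      by (auto simp: monom_altdef one_pCons pderiv_pCons)
  next
    case (insert q \<rho>)
    have cop: "coprime q (\<Prod>\<rho>)"
      using insert.prems(2) insert.hyps(2)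
      by (intro prod_coprime_right) (auto simp: pairwise_insert)
    have IH: "sign_factor \<rho> True = incl_excl_poly \<rho> * sign_factor \<rho> False"
      "cyclotomic_like (\<Prod>\<rho>) (incl_excl_poly \<rho>)"
      using insert by (auto simp: pairwise_insert)
    note aux = incl_excl_poly_insert_if[OF insert.hyps(1) insert.prems(1) insert.hyps(2) cop IH]
    have "cyclotomic_like (\<Prod>\<rho> * q) (incl_excl_poly (insert q \<rho>))"
      using IH(2) _ _ cop aux(1) by (rule cyclotomic_like_quotient) (auto simp: insert.prems prod_pos)
    with aux(2) insert.hyps show ?case by (simp add: mult.commute)
  qed
  then show "sign_factor \<rho> True = incl_excl_poly \<rho> * sign_factor \<rho> False"
    and "cyclotomic_like (\<Prod>\<rho>) (incl_excl_poly \<rho>)" by auto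
qed

lemma incl_excl_poly_insert:
  assumes "finite \<rho>" "\<And>r. r \<in> insert q \<rho> \<Longrightarrow> r > 0" "pairwise coprime \<rho>"
    and "q \<notin> \<rho>" "coprime q (\<Prod>\<rho>)"
  shows "incl_excl_poly (insert q \<rho>) * incl_excl_poly \<rho> = incl_excl_poly \<rho> \<circ>\<^sub>p monom 1 q"
proof -
  have "\<And>r. r \<in> \<rho> \<Longrightarrow> r > 0" using assms(2) by auto
  note wb = incl_excl_poly_cyclotomic_like[OF assms(1) this assms(3)]
  show ?thesis
    by (rule incl_excl_poly_insert_if(1)[OF assms(1,2,4,5) wb])
qed

section \<open>Values and limits on the unit circle\<close>

lemma norm_poly_le_height:
  assumes "cmod x = 1"
  shows "cmod (poly (cpoly p) x) \<le> (real (degree p) + 1) * of_int (poly_height p)"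
proof -
  have le: "cmod (coeff (cpoly p) i * x ^ i) \<le> of_int (poly_height p)" if "i \<le> degree p" for i
  proof -
    have "\<bar>coeff p i\<bar> \<le> poly_height p"
      unfolding poly_height_def using that by (intro Max_ge) auto
    then have "of_int \<bar>coeff p i\<bar> \<le> (of_int (poly_height p) :: real)" by (simp only: of_int_le_iff)
    then show ?thesis using assms by (simp add: coeff_map_poly norm_mult norm_power)
  qed
  have "cmod (poly (cpoly p) x) \<le> (\<Sum>i\<le>degree p. cmod (coeff (cpoly p) i * x ^ i))"
    unfolding poly_altdef degree_cpoly by (rule norm_sum)
  also have "\<dots> \<le> (\<Sum>i\<le>degree p. of_int (poly_height p))"
    using le by (intro sum_mono) auto
  finally show ?thesis by (simp add: add.commute)
qed

abbreviation unit_pt :: "real \<Rightarrow> complex" where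
  "unit_pt t \<equiv> cis (2 * pi * t)"

lemma unit_pt_power: "unit_pt t ^ n = unit_pt (real n * t)"
  by (simp add: DeMoivre mult_ac)

lemma unit_pt_add_int: "unit_pt (t + of_int n) = unit_pt t"
  by (simp add: distrib_left cis_mult[symmetric] cis_multiple_2pi)

text \<open>First-order expansion at a root: changing the angle by \<open>\<tau> / n\<close> moves
  the point by about \<open>2 * pi * \<tau> / n\<close>, and the factor \<open>n\<close> cancels the
  decay.\<close>

lemma tendsto_scaled_poly_at_root:
  fixes F :: "complex poly"
  assumes "poly F (unit_pt u) = 0"
  shows "(\<lambda>n. real n * cmod (poly F (unit_pt (u + \<tau> / real n))))
           \<longlonglongrightarrow> 2 * pi * \<bar>\<tau>\<bar> * cmod (poly (pderiv F) (unit_pt u))"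
proof -
  define f where "f = (\<lambda>s. poly F (exp (2 * of_real pi * \<i> * (of_real u + of_real \<tau> * s))))"
  define D where "D = poly (pderiv F) (unit_pt u) * (unit_pt u * (2 * of_real pi * \<i> * of_real \<tau>))"
  have f_real: "f (of_real s) = poly F (unit_pt (u + \<tau> * s))" for s
    by (simp add: f_def cis_conv_exp algebra_simps)
  have "(f has_field_derivative D) (at 0)"
    unfolding f_def D_def
    by (rule DERIV_chain2[OF poly_DERIV] derivative_eq_intros refl)+
       (simp_all add: cis_conv_exp algebra_simps)
  then have lim: "((\<lambda>h. (f h - f 0) / h) \<longlongrightarrow> D) (at 0)"
    by (simp add: DERIV_def)
  have "filterlim (\<lambda>n. of_real (1 / real n) :: complex) (at 0) sequentially"
    unfolding filterlim_at
  proof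
    show "\<forall>\<^sub>F n in sequentially. complex_of_real (1 / real n) \<in> UNIV \<and> complex_of_real (1 / real n) \<noteq> 0"
      using eventually_gt_at_top[of 0] by eventually_elim simp
    show "(\<lambda>n. complex_of_real (1 / real n)) \<longlonglongrightarrow> 0"
      using tendsto_of_real[OF lim_1_over_n, where 'a = complex] by simp
  qed
  from tendsto_norm[OF filterlim_compose[OF lim this]]
  have "(\<lambda>n. cmod ((f (of_real (1 / real n)) - f 0) / of_real (1 / real n))) \<longlonglongrightarrow> cmod D" .
  moreover have "f 0 = 0" using f_real[of 0] assms by simp
  moreover have "cmod D = 2 * pi * \<bar>\<tau>\<bar> * cmod (poly (pderiv F) (unit_pt u))"
    by (simp add: D_def norm_mult)
  ultimately show ?thesis
    by (simp only: f_real norm_divide diff_zero) (simp add: norm_divide mult.commute)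
qed

text \<open>Approximates \<open>y\<close> by fractions whose denominators come from a prescribed
  family, so that these can later be kept coprime to \<open>m\<close>.\<close>

lemma tendsto_floor_mult_divide:
  fixes d :: "'a \<Rightarrow> real"
  assumes "filterlim d at_top F"
  shows "((\<lambda>n. of_int \<lfloor>y * d n\<rfloor> / d n) \<longlongrightarrow> y) F"
proof (rule tendsto_sandwich)
  have "((\<lambda>n. inverse (d n)) \<longlongrightarrow> 0) F"
    using assms by (intro tendsto_inverse_0_at_top)
  from tendsto_diff[OF tendsto_const this] show "((\<lambda>n. y - inverse (d n)) \<longlongrightarrow> y) F"
    by simp
  have pos: "\<forall>\<^sub>F n in F. d n > 0"
    using assms by (simp add: filterlim_at_top_dense)
  show "\<forall>\<^sub>F n in F. y - inverse (d n) \<le> of_int \<lfloor>y * d n\<rfloor> / d n"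
    using pos
  proof eventually_elim
    case (elim n)
    have "y * d n - 1 \<le> of_int \<lfloor>y * d n\<rfloor>" by linarith
    with elim show ?case by (simp add: pos_le_divide_eq left_diff_distrib)
  qed
  show "\<forall>\<^sub>F n in F. of_int \<lfloor>y * d n\<rfloor> / d n \<le> y"
    using pos by eventually_elim (simp add: divide_le_eq)
qed simp

section \<open>Choosing the new modulus and lifting the two points\<close>

text \<open>Chinese remaindering modulo \<open>m\<close> and modulo the product \<open>L\<close> of
  \<open>B\<close>, \<open>|E|\<close> and \<open>K\<close>. Being 1 modulo \<open>L\<close> yields
  both congruences to 1 and coprimality to \<open>K\<close>; coprimality to \<open>m\<close> is
  inherited from \<open>a\<close>.\<close>

lemma exists_large_modulus:
  fixes z a A B E :: int and m K Q :: nat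
  assumes "m > 0" "K > 0" "B > 0" "E \<noteq> 0"
    and cop: "coprime z (int m)" "coprime a (int m)" "coprime B (int m)" "coprime E (int m)"
      "coprime (int K) (int m)"
  obtains q :: nat where "q > Q" "[int q * z = a] (mod int m)" "coprime q m" "coprime q K"
    "[int q = 1] (mod B)" "[int q = 1] (mod E)"
proof -
  define L where "L = B * \<bar>E\<bar> * int K"
  have "L > 0" using assms by (simp add: L_def)
  have "coprime L (int m)" using cop by (simp add: L_def)
  obtain w where w: "[z * w = 1] (mod int m)"
    using cong_solve_coprime_int[OF cop(1)] by blast
  obtain x where x: "[x = 1] (mod L)" "[x = w * a] (mod int m)"
    using binary_chinese_remainder_int[OF \<open>coprime L (int m)\<close>] by blast
  define q where "q = x mod (L * int m) + (int Q + 1) * (L * int m)"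
  have Lm: "L * int m \<ge> 1" using \<open>L > 0\<close> \<open>m > 0\<close> by (simp add: int_one_le_iff_zero_less)
  have "(int Q + 1) * 1 \<le> (int Q + 1) * (L * int m)"
    using Lm by (intro mult_left_mono) auto
  moreover have "q \<ge> (int Q + 1) * (L * int m)" using Lm by (simp add: q_def)
  ultimately have q: "q > int Q" by (simp only: mult_1_right)
  have "[q = x] (mod L * int m)"
    by (simp only: q_def unique_euclidean_semiring_class.cong_def mod_mult_self1 mod_mod_trivial)
  then have qx: "[q = x] (mod L)" "[q = x] (mod int m)"
    by (auto intro: cong_modulus_mult simp: mult.commute)
  have q1: "[q = 1] (mod L)" using qx(1) x(1) by (rule cong_trans)
  have qa: "[q * z = a] (mod int m)"
  proof -
    have "[q * z = (w * a) * z] (mod int m)"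
      using qx(2) x(2) by (intro cong_scalar_right) (rule cong_trans)
    also have "(w * a) * z = (z * w) * a" by (simp add: mult_ac)
    also have "[(z * w) * a = 1 * a] (mod int m)" using w by (rule cong_scalar_right)
    finally show ?thesis by simp
  qed
  have "coprime (q * z) (int m)"
    using cop(2) cong_imp_coprime[OF cong_sym[OF qa]] by simp
  then have qm: "coprime q (int m)" by simp
  have d1: "[q = 1] (mod d)" if "d dvd L" for d
    using q1 that by (rule cong_dvd_modulus)
  have "coprime q (int K)"
    using cong_imp_coprime[OF cong_sym[OF d1[of "int K"]]] by (simp add: L_def)
  then show ?thesis
    using q qa qm d1[of B] d1[of E]
    by (intro that[of "nat q"]) (auto simp: L_def simp flip: coprime_int_iff)
qed

text \<open>
  Besides the two analytic bounds, the new pair \<open>z'\<close>, \<open>a'\<close> has to be coprime to \<open>mq\<close> again. For \<open>a' = qz + 1\<close>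
  this is left to the caller, who knows the residues of \<open>a + 1\<close>. For \<open>z'\<close> it is arranged by
  approximating \<open>y\<close> by a fraction \<open>A/B\<close> and taking \<open>z' = z + mA(q - 1)/B\<close>: a common divisor of \<open>z'\<close>
  and \<open>q\<close> divides \<open>E = Bz - Am\<close>, which is nonzero as \<open>e(A/B)\<close> is not a root, so \<open>q \<equiv> 1 (mod E)\<close>
  suffices.
\<close>

lemma lift_step:
  fixes F :: "complex poly" and m K Q :: nat and z a :: int and y X W R :: real
  assumes "m > 0" "K > 0" and z: "coprime z (int m)" and a: "coprime a (int m)"
    and K: "coprime K m"
    and root: "poly F (unit_pt (of_int z / m)) = 0"
    and deriv: "cmod (poly (pderiv F) (unit_pt (of_int z / m))) \<le> m / W"
    and large: "X * m < cmod (poly F (unit_pt y))"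
    and near: "\<bar>m * y - of_int a\<bar> < R"
    and "X > 0" "W > 0"
  obtains q :: nat and z' a' :: int and y' :: real
  where "q > Q" "coprime q m" "coprime q K" "coprime z' (int (m * q))"
    "[a' = a + 1] (mod int m)" "[a' = 1] (mod int q)" "\<bar>real (m * q) * y' - of_int a'\<bar> < R + 1"
    "\<And>T. (\<And>x. poly T x * poly F x = poly F (x ^ q)) \<Longrightarrow>
       poly T (unit_pt (of_int z' / real (m * q))) = 0 \<and>
       cmod (poly (pderiv T) (unit_pt (of_int z' / real (m * q)))) \<le> real q / (W * X) \<and>
       X * W / (8 * R) * real (m * q) < cmod (poly T (unit_pt y'))"
proof -
  have "R > 0" using near by linarith
  define \<tau> where "\<tau> = y - of_int a / m"
  have cont: "isCont (\<lambda>t. cmod (poly F (unit_pt t))) t" for t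
    unfolding cis_conv_exp by (intro continuous_intros)
  \<comment> \<open>A denominator of the form \<open>n * m + 1\<close> is coprime to
    \<open>m\<close>, and the fraction is close enough to \<open>y\<close> to keep the lower
    bound.\<close>
  obtain n :: nat where n: "X * m < cmod (poly F (unit_pt (of_int \<lfloor>y * real (n * m + 1)\<rfloor> / real (n * m + 1))))"
  proof -
    have "filterlim (\<lambda>n. real (n * m + 1)) at_top sequentially"
      using \<open>m > 0\<close> by (simp only: of_nat_add of_nat_mult of_nat_1) real_asymp
    note lim = tendsto_floor_mult_divide[OF this, of y]
    from eventually_happens'[OF sequentially_bot
        order_tendstoD(1)[OF isCont_tendsto_compose[OF cont lim] large]]
    show ?thesis using that by blast
  qed
  define B :: int where "B = int (n * m + 1)"
  define A where "A = \<lfloor>y * real (n * m + 1)\<rfloor>"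
  have "B > 0" unfolding B_def of_nat_0_less_iff by simp
  have AB: "X * m < cmod (poly F (unit_pt (of_int A / of_int B)))"
    unfolding A_def B_def of_int_of_nat_eq by (rule n)
  have Bm: "coprime B (int m)"
    using cong_imp_coprime[of 1 B "int m"] by (simp add: B_def cong_iff_dvd_diff)
  define E where "E = B * z - A * int m"
  have "coprime E (int m)"
  proof -
    have "[E = B * z] (mod int m)" by (simp add: E_def cong_iff_dvd_diff)
    moreover have "coprime (B * z) (int m)" using Bm z by simp
    ultimately show ?thesis using cong_imp_coprime cong_sym by blast
  qed
  have "E \<noteq> 0"
  proof
    assume "E = 0"
    then have "of_int (B * z) = (of_int (A * int m) :: real)" by (simp add: E_def)
    then have "of_int z / real m = of_int A / of_int B"
      using \<open>B > 0\<close> \<open>m > 0\<close> by (simp add: field_simps)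
    with root AB have "X * m < 0" by simp
    then show False using \<open>X > 0\<close> by (simp add: mult_less_0_iff)
  qed
  \<comment> \<open>For \<open>z' = z + m * A * (q - 1) / B\<close> this is the point
    \<open>z' / (m * q)\<close>. Writing it as a function of \<open>q\<close> allows the threshold
    for \<open>q\<close> to be fixed before \<open>q\<close> is chosen.\<close>
  have "(\<lambda>q. of_int z / (real m * real q) + of_int A / of_int B * (1 - 1 / real q)) \<longlonglongrightarrow> of_int A / of_int B"
    using \<open>m > 0\<close> \<open>B > 0\<close> by real_asymp
  from order_tendstoD(1)[OF isCont_tendsto_compose[OF cont this] AB]
  have ev1: "\<forall>\<^sub>F q in sequentially. X * m < cmod (poly F (unit_pt
      (of_int z / (real m * real q) + of_int A / of_int B * (1 - 1 / real q))))" .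
  \<comment> \<open>The factor \<open>8 * R\<close> arises here, from 2 pi < 8 and
    \<open>m * |\<tau>| < R\<close>.\<close>
  have lim2: "2 * pi * \<bar>\<tau>\<bar> * cmod (poly (pderiv F) (unit_pt (of_int z / m))) < 8 * R / W"
  proof -
    have "\<bar>\<tau>\<bar> * m = \<bar>m * y - of_int a\<bar>"
      using \<open>m > 0\<close> by (simp add: \<tau>_def abs_mult_pos field_simps)
    have "2 * pi * \<bar>\<tau>\<bar> * cmod (poly (pderiv F) (unit_pt (of_int z / m))) \<le> 2 * pi * \<bar>\<tau>\<bar> * (m / W)"
      using deriv by (intro mult_left_mono) auto
    also have "\<dots> = 2 * pi * (\<bar>m * y - of_int a\<bar> / W)"
      unfolding \<open>\<bar>\<tau>\<bar> * m = _\<close>[symmetric] by simp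
    also have "\<dots> \<le> 2 * pi * (R / W)"
      using near \<open>W > 0\<close> by (intro mult_left_mono divide_right_mono) auto
    also have "\<dots> < 8 * (R / W)"
      using pi_less_4 \<open>R > 0\<close> \<open>W > 0\<close> by (intro mult_strict_right_mono) auto
    finally show ?thesis by simp
  qed
  have ev2: "\<forall>\<^sub>F q in sequentially. real q * cmod (poly F (unit_pt (of_int z / m + \<tau> / real q))) < 8 * R / W"
    using order_tendstoD(2)[OF tendsto_scaled_poly_at_root[OF root] lim2] .
  obtain Q' where Q': "\<And>q. q \<ge> Q' \<Longrightarrow>
      X * m < cmod (poly F (unit_pt (of_int z / (real m * real q) + of_int A / of_int B * (1 - 1 / real q)))) \<and>
      real q * cmod (poly F (unit_pt (of_int z / m + \<tau> / real q))) < 8 * R / W"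
    using eventually_conj[OF ev1 ev2] by (auto simp: eventually_sequentially)
  obtain q where q: "q > max Q Q'" "[int q * z = a] (mod int m)" "coprime q m" "coprime q K"
    "[int q = 1] (mod B)" "[int q = 1] (mod E)"
    using exists_large_modulus[OF \<open>m > 0\<close> \<open>K > 0\<close> \<open>B > 0\<close> \<open>E \<noteq> 0\<close> z a Bm \<open>coprime E _\<close>]
      K by (metis coprime_int_iff)
  have "q > 0" using q(1) by simp
  obtain b where b: "int q - 1 = B * b"
    using q(5) by (auto simp: cong_iff_dvd_diff elim: dvdE)
  define z' where "z' = z + int m * (A * b)"
  \<comment> \<open>The shift by 1 makes \<open>a'\<close> congruent to 1 modulo \<open>q\<close>,
    whatever \<open>z\<close> is; it costs at most 1 in the distance to
    \<open>m * q * y'\<close>.\<close>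
  define a' where "a' = z * int q + 1"
  \<comment> \<open>Modulo 1, \<open>q * y'\<close> equals \<open>a / m + \<tau> = y\<close>, so the
    \<open>q\<close>-th power maps the new point to the old one, while \<open>y'\<close> lies within
    \<open>|\<tau>| / q\<close> of the root angle \<open>z / m\<close>.\<close>
  define y' where "y' = of_int z / m + \<tau> / real q"
  have z'q: "coprime z' (int q)"
  proof (rule coprimeI)
    fix d assume d: "d dvd z'" "d dvd int q"
    have "B * z' = B * z + int m * A * (B * b)" by (simp add: z'_def algebra_simps)
    also have "\<dots> = E + int q * (int m * A)" unfolding b[symmetric] by (simp add: E_def algebra_simps)
    finally have "E = B * z' - int q * (int m * A)" by simp
    then have "d dvd E" using d by (metis dvd_diff dvd_mult dvd_mult2)
    moreover have "E dvd int q - 1" using q(6) by (simp add: cong_iff_dvd_diff)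
    ultimately have "d dvd int q - 1" by (rule dvd_trans)
    with d(2) show "is_unit d" by (metis dvd_diff_right_iff)
  qed
  have z'm: "coprime z' (int m)"
  proof -
    have "[z' = z] (mod int m)" by (simp add: z'_def cong_iff_dvd_diff)
    then show ?thesis using z cong_imp_coprime cong_sym by blast
  qed
  have zz': "of_int z' / real (m * q) = of_int z / (real m * real q) + of_int A / of_int B * (1 - 1 / real q)"
  proof -
    have "(of_int (int q - 1) :: real) = of_int B * of_int b" unfolding b by simp
    then have b': "of_int b = (real q - 1) / of_int B" using \<open>B > 0\<close> by (simp add: field_simps)
    show ?thesis using \<open>m > 0\<close> \<open>q > 0\<close> \<open>B > 0\<close> by (simp add: z'_def b' field_simps)
  qed
  have power_z': "unit_pt (of_int z' / real (m * q)) ^ q = unit_pt (of_int z / m)"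
  proof -
    have "real q * (of_int z' / real (m * q)) = of_int z / m + of_int (A * b)"
      using \<open>m > 0\<close> \<open>q > 0\<close> by (simp add: z'_def field_simps)
    then show ?thesis by (simp only: unit_pt_power unit_pt_add_int)
  qed
  have power_y': "unit_pt y' ^ q = unit_pt y"
  proof -
    obtain c where c: "int q * z - a = int m * c"
      using q(2) by (auto simp: cong_iff_dvd_diff elim: dvdE)
    have "(of_int (int q * z - a) :: real) = real m * of_int c" unfolding c by simp
    then have "real q * y' = y + of_int c"
      using \<open>m > 0\<close> \<open>q > 0\<close> by (simp add: y'_def \<tau>_def field_simps)
    then show ?thesis by (simp only: unit_pt_power unit_pt_add_int)
  qed
  show ?thesis
  proof (rule that)
    show "q > Q" using q(1) by simp
    show "coprime q m" "coprime q K" by fact+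
    show "coprime z' (int (m * q))" using z'q z'm by simp
    show "[a' = a + 1] (mod int m)"
      unfolding a'_def using cong_add[OF q(2) cong_refl[of 1]] by (simp add: mult.commute)
    show "[a' = 1] (mod int q)" by (simp add: a'_def cong_iff_dvd_diff)
    have "real (m * q) * y' - of_int a' = (real m * y - of_int a) - 1"
      using \<open>m > 0\<close> \<open>q > 0\<close> by (simp add: y'_def a'_def \<tau>_def field_simps)
    then show "\<bar>real (m * q) * y' - of_int a'\<bar> < R + 1" using near by linarith
  next
    fix T assume T: "\<And>x. poly T x * poly F x = poly F (x ^ q)"
    define \<xi> where "\<xi> = unit_pt (of_int z' / real (m * q))"
    have \<xi>q: "\<xi> ^ q = unit_pt (of_int z / m)" using power_z' by (simp add: \<xi>_def)
    have F\<xi>: "X * m < cmod (poly F \<xi>)" using Q'[of q] q(1) zz' by (simp add: \<xi>_def)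
    have Xm: "X * m > 0" using \<open>X > 0\<close> \<open>m > 0\<close> by simp
    have T\<xi>: "poly T \<xi> = 0" using T[of \<xi>] F\<xi> Xm root by (auto simp: \<xi>q)
    \<comment> \<open>Differentiating this at the root \<open>\<xi>\<close> of \<open>T\<close>
      leaves only \<open>T' F\<close> on the left, and \<open>F\<close> is large at
      \<open>\<xi>\<close>.\<close>
    have "T * F = F \<circ>\<^sub>p monom 1 q"
      by (rule poly_ext) (simp add: T poly_pcompose poly_monom)
    then have "poly (pderiv (T * F)) \<xi> = of_nat q * \<xi> ^ (q - 1) * poly (pderiv F) (\<xi> ^ q)"
      by (simp only: pderiv_pcompose_monom)
    then have "poly (pderiv T) \<xi> * poly F \<xi> = of_nat q * \<xi> ^ (q - 1) * poly (pderiv F) (\<xi> ^ q)"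
      using T\<xi> by (simp add: pderiv_mult mult.commute)
    then have "cmod (poly (pderiv T) \<xi>) * cmod (poly F \<xi>) = real q * cmod (poly (pderiv F) (\<xi> ^ q))"
      by (metis (no_types) \<xi>_def norm_cis norm_mult norm_of_nat norm_power power_one mult.right_neutral)
    also have "\<dots> \<le> real q * (m / W)"
      using deriv unfolding \<xi>q by (intro mult_left_mono) auto
    finally have "cmod (poly (pderiv T) \<xi>) * cmod (poly F \<xi>) \<le> real q * (m / W)" .
    moreover have "cmod (poly (pderiv T) \<xi>) * (X * m) \<le> cmod (poly (pderiv T) \<xi>) * cmod (poly F \<xi>)"
      using F\<xi> by (intro mult_left_mono) auto
    ultimately have "cmod (poly (pderiv T) \<xi>) * (X * m) \<le> real q * (m / W)" by linarith
    then have bound: "cmod (poly (pderiv T) \<xi>) \<le> real q / (W * X)"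
      using Xm \<open>W > 0\<close> \<open>m > 0\<close> \<open>X > 0\<close> by (simp add: field_simps)
    \<comment> \<open>\<open>t\<close> is small since \<open>y'\<close> is near the root, so
      \<open>T\<close>, being \<open>F(e(y))\<close> over \<open>F(e(y'))\<close>, is large. Working
      with the product spares a separate proof that \<open>t\<close> is nonzero.\<close>
    define t where "t = cmod (poly F (unit_pt y'))"
    have "cmod (poly T (unit_pt y')) * t = cmod (poly F (unit_pt y))"
      using T[of "unit_pt y'"] by (simp add: t_def power_y' flip: norm_mult)
    then have gt: "cmod (poly T (unit_pt y')) * t > X * m" using large by simp
    have "real q * t < 8 * R / W"
      using Q'[of q] q(1) by (simp add: t_def y'_def)
    then have "t < 8 * R / W / real q"
      using \<open>q > 0\<close> by (subst pos_less_divide_eq) (simp_all only: mult.commute of_nat_0_less_iff)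
    then have "cmod (poly T (unit_pt y')) * t \<le> cmod (poly T (unit_pt y')) * (8 * R / W / real q)"
      by (intro mult_left_mono) auto
    with gt have "X * m < cmod (poly T (unit_pt y')) * (8 * R / W / real q)" by linarith
    then have "X * W / (8 * R) * real (m * q) < cmod (poly T (unit_pt y'))"
      using \<open>R > 0\<close> \<open>W > 0\<close> \<open>q > 0\<close> by (simp add: field_simps)
    with T\<xi> bound show "poly T (unit_pt (of_int z' / real (m * q))) = 0 \<and>
       cmod (poly (pderiv T) (unit_pt (of_int z' / real (m * q)))) \<le> real q / (W * X) \<and>
       X * W / (8 * R) * real (m * q) < cmod (poly T (unit_pt y'))"
      by (simp add: \<xi>_def)
  qed
qed

section \<open>The recursion of \<open>M_rho\<close> and the resulting scale\<close>

text \<open>For \<open>j \<le> k - 2\<close> the exponent doubles and gains one, as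
  \<open>2^(n+1) - 1 = 2 * (2^n - 1) + 1\<close>; the factor for \<open>j = k - 1\<close> is new and
  has exponent 1.\<close>

lemma M_rho_Suc: "M_rho (Suc k) q = (M_rho k q)\<^sup>2 * (\<Prod>i = 1..k - 1. q i)"
proof (cases "k \<le> 1")
  case True
  then show ?thesis by (auto simp: M_rho_def le_Suc_eq)
next
  case False
  then obtain l where k: "k = Suc (Suc l)"
    by (metis One_nat_def Suc_le_mono le0 not0_implies_Suc le_numeral_extra(4))
  have exp: "q j ^ (2 ^ (Suc k - j - 1) - 1) = (q j ^ (2 ^ (k - j - 1) - 1))\<^sup>2 * q j" if "j \<le> l" for j
  proof -
    have "Suc k - j - 1 = Suc (k - j - 1)" using that k by simp
    moreover have "(2::nat) ^ (k - j - 1) \<ge> 1" by simp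
    ultimately have "2 ^ (Suc k - j - 1) - 1 = Suc ((2 ^ (k - j - 1) - 1) * 2 :: nat)"
      by (simp only: power_Suc) linarith
    then show ?thesis by (simp only: power_Suc2 power_mult)
  qed
  have "M_rho (Suc k) q = (\<Prod>j = 1..l. q j ^ (2 ^ (Suc k - j - 1) - 1)) * q (Suc l)"
    by (simp add: M_rho_def k)
  also have "\<dots> = (\<Prod>j = 1..l. (q j ^ (2 ^ (k - j - 1) - 1))\<^sup>2 * q j) * q (Suc l)"
    using exp by (intro arg_cong2[where f = "(*)"] prod.cong refl) auto
  also have "\<dots> = (M_rho k q)\<^sup>2 * (\<Prod>i = 1..k - 1. q i)"
    by (simp add: M_rho_def k prod.distrib prod_power_distrib)
  finally show ?thesis .
qed

lemma M_rho_cong: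
  assumes "\<And>i. i \<in> {1..k} \<Longrightarrow> q i = q' i"
  shows "M_rho k q = M_rho k q'"
  unfolding M_rho_def using assms by (intro prod.cong) auto

text \<open>
  The factor \<open>8(k + 2)\<close> absorbs the losses \<open>8(k + 1)\<close> of the single steps, because
  \<open>(k + 1)(k + 3) \<le> (k + 2)\<^sup>2\<close>.
\<close>

definition coeff_scale :: "nat \<Rightarrow> (nat \<Rightarrow> nat) \<Rightarrow> real" where
  "coeff_scale k q = 8 * (real k + 2) * (1 / 16) ^ (2 ^ k) * real (M_rho k q)"

lemma coeff_scale_Suc_le:
  "coeff_scale (Suc k) q \<le> (coeff_scale k q)\<^sup>2 * real (\<Prod>i = 1..k - 1. q i) / (8 * (real k + 1))"
proof -
  define b :: real where "b = (1 / 16) ^ (2 ^ Suc k)"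
  define c where "c = real ((M_rho k q)\<^sup>2 * (\<Prod>i = 1..k - 1. q i))"
  have b: "((1 / 16) ^ (2 ^ k))\<^sup>2 = b" by (simp add: b_def mult.commute flip: power_mult)
  have "(real k + 3) * (real k + 1) \<le> (real k + 2)\<^sup>2" by (simp add: power2_eq_square algebra_simps)
  then have "8 * (real k + 3) \<le> (8 * (real k + 2))\<^sup>2 / (8 * (real k + 1))"
    by (simp add: power2_eq_square field_simps)
  then have "8 * (real k + 3) * (b * c) \<le> (8 * (real k + 2))\<^sup>2 / (8 * (real k + 1)) * (b * c)"
    unfolding b_def c_def by (rule mult_right_mono) (intro mult_nonneg_nonneg of_nat_0_le_iff zero_le_power, simp)
  also have "\<dots> = (coeff_scale k q)\<^sup>2 * real (\<Prod>i = 1..k - 1. q i) / (8 * (real k + 1))"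
    by (simp add: coeff_scale_def power_mult_distrib b c_def)
  also have "8 * (real k + 3) * (b * c) = coeff_scale (Suc k) q"
    unfolding coeff_scale_def M_rho_Suc c_def b_def by (simp add: add_ac)
  finally show ?thesis .
qed

lemma M_rho_pos: "(\<And>i. i \<in> {1..k} \<Longrightarrow> q i > 0) \<Longrightarrow> M_rho k q > 0"
  unfolding M_rho_def by (intro prod_pos) auto

lemma coeff_scale_pos: "(\<And>i. i \<in> {1..k} \<Longrightarrow> q i > 0) \<Longrightarrow> coeff_scale k q > 0"
  using M_rho_pos[of k q] by (simp add: coeff_scale_def)

section \<open>Induction on the number of moduli\<close>

text \<open>\<open>K\<close> bounds the number of moduli ultimately wanted and is fixed before the
  induction, so that coprimality to \<open>K!\<close> serves every later step.\<close>

definition admissible :: "nat \<Rightarrow> nat \<Rightarrow> nat \<Rightarrow> (nat \<Rightarrow> nat) \<Rightarrow> bool" where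
  "admissible K N k q \<longleftrightarrow>
     (\<forall>i\<in>{1..k}. q i > N \<and> coprime (q i) (fact K)) \<and> strict_mono_on {1..k} q \<and>
     (\<forall>i\<in>{1..k}. \<forall>j\<in>{1..k}. i \<noteq> j \<longrightarrow> coprime (q i) (q j))"

text \<open>
  The residues of \<open>a\<close> are the integers \<open>1, \<dots>, k\<close>, whatever the moduli are. Since the \<open>q\<^sub>i\<close> are coprime to
  \<open>K!\<close>, this keeps \<open>a\<close> coprime to \<open>m\<close> as long as \<open>k \<le> K\<close>, at the price of letting \<open>a\<close> drift away
  from \<open>my\<close> by one in each step.
\<close>

definition extremal :: "nat \<Rightarrow> (nat \<Rightarrow> nat) \<Rightarrow> int \<Rightarrow> int \<Rightarrow> real \<Rightarrow> bool" where
  "extremal k q z a y \<longleftrightarrow>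
     (let m = \<Prod>i = 1..k. q i; F = cpoly (incl_excl_poly (q ` {1..k})); X = coeff_scale k q in
      coprime z (int m) \<and> (\<forall>i\<in>{1..k}. [a = int (k - i + 1)] (mod int (q i))) \<and>
      \<bar>real m * y - of_int a\<bar> < real k + 1 \<and>
      poly F (unit_pt (of_int z / real m)) = 0 \<and>
      cmod (poly (pderiv F) (unit_pt (of_int z / real m)))
        \<le> real m / (X * real (\<Prod>i = 1..k - 1. q i)) \<and>
      X * real m < cmod (poly F (unit_pt y)))"

lemma admissible_props:
  assumes "admissible K N k q"
  shows "\<And>i. i \<in> {1..k} \<Longrightarrow> q i > 0" "inj_on q {1..k}" "pairwise coprime (q ` {1..k})"
    "\<Prod>(q ` {1..k}) = (\<Prod>i = 1..k. q i)"
proof -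
  show "q i > 0" if "i \<in> {1..k}" for i
    using assms that unfolding admissible_def by (metis gr_zeroI not_less_zero)
  show inj: "inj_on q {1..k}"
    using assms by (auto simp: admissible_def intro: strict_mono_on_imp_inj_on)
  show "pairwise coprime (q ` {1..k})"
    using assms by (auto simp: admissible_def pairwise_def)
  show "\<Prod>(q ` {1..k}) = (\<Prod>i = 1..k. q i)"
    using prod.reindex[OF inj, of id] by simp
qed

text \<open>Here \<open>Q = 1 - x\<close> and \<open>m = 1\<close>: the root is 1 and the value at
  -1 has modulus 2. The base 1/16 in \<open>coeff_scale\<close> makes the scale equal to 1 at
  \<open>k = 0\<close>, the largest value that the derivative bound permits.\<close>

lemma extremal_empty: "extremal 0 q 0 0 (1 / 2)"
proof -
  have "cpoly [:1, -1:] = [:1, -1:]" by (simp add: map_poly_pCons)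
  then show ?thesis
    by (simp add: extremal_def incl_excl_poly_empty coeff_scale_def M_rho_def pderiv_pCons)
qed

lemma extremal_Suc:
  assumes adm: "admissible K N k q" and "k < K" and ext: "extremal k q z a y"
  obtains q' z' a' y' where "admissible K N (Suc k) q'" "extremal (Suc k) q' z' a' y'"
proof -
  define m where "m = (\<Prod>i = 1..k. q i)"
  define F where "F = cpoly (incl_excl_poly (q ` {1..k}))"
  define X where "X = coeff_scale k q"
  define P where "P = (\<Prod>i = 1..k - 1. q i)"
  have z: "coprime z (int m)" and a: "\<And>i. i \<in> {1..k} \<Longrightarrow> [a = int (k - i + 1)] (mod int (q i))"
    and near: "\<bar>real m * y - of_int a\<bar> < real k + 1"
    and root: "poly F (unit_pt (of_int z / real m)) = 0"
    and deriv: "cmod (poly (pderiv F) (unit_pt (of_int z / real m))) \<le> real m / (X * real P)"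
    and large: "X * real m < cmod (poly F (unit_pt y))"
    using ext unfolding extremal_def Let_def m_def F_def X_def P_def by auto
  note pos = admissible_props(1)[OF adm]
  have "m > 0" unfolding m_def using pos by (intro prod_pos) auto
  have "X > 0" unfolding X_def using pos by (intro coeff_scale_pos)
  have "P > 0" unfolding P_def using pos by (intro prod_pos) auto
  have XP: "X * real P > 0" using \<open>X > 0\<close> \<open>P > 0\<close> by simp
  have fK: "coprime (fact K) m"
    unfolding m_def using adm by (intro prod_coprime_right) (auto simp: admissible_def coprime_commute)
  have am: "coprime a (int m)"
  proof -
    have "coprime a (int (q i))" if i: "i \<in> {1..k}" for i
    proof -
      have "k - i + 1 dvd fact K" using i \<open>k < K\<close> by (intro dvd_fact) auto
      then have "coprime (k - i + 1) (q i)"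
        using adm i by (meson admissible_def coprime_commute coprime_divisors dvd_refl)
      then have "coprime (int (k - i + 1)) (int (q i))" by (simp only: coprime_int_iff)
      then show ?thesis using cong_imp_coprime cong_sym[OF a[OF i]] by blast
    qed
    then show ?thesis unfolding m_def of_nat_prod by (intro prod_coprime_right)
  qed
  \<comment> \<open>Exceeding \<open>Q\<close> puts the new modulus above \<open>N\<close> and above
    all earlier moduli.\<close>
  define Q where "Q = N + (\<Sum>i = 1..k. q i)"
  have fK0: "(fact K :: nat) > 0" by simp
  \<comment> \<open>The lifting step is used with \<open>W = X * P\<close>, \<open>R = k + 1\<close>
    and \<open>fact K\<close> as the number to which the new modulus must be coprime.\<close>
  obtain p z' a' y' where p: "p > Q" "coprime p m" "coprime p (fact K)"
    and z': "coprime z' (int (m * p))"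
    and a': "[a' = a + 1] (mod int m)" "[a' = 1] (mod int p)"
      "\<bar>real (m * p) * y' - of_int a'\<bar> < real k + 1 + 1"
    and T: "\<And>T. (\<And>x. poly T x * poly F x = poly F (x ^ p)) \<Longrightarrow>
       poly T (unit_pt (of_int z' / real (m * p))) = 0 \<and>
       cmod (poly (pderiv T) (unit_pt (of_int z' / real (m * p)))) \<le> real p / ((X * real P) * X) \<and>
       X * (X * real P) / (8 * (real k + 1)) * real (m * p) < cmod (poly T (unit_pt y'))"
    using lift_step[OF \<open>m > 0\<close> fK0 z am fK root deriv large near \<open>X > 0\<close> XP] by metis
  define q' where "q' = q(Suc k := p)"
  have q'_le: "q' i = q i" if "i \<in> {1..k}" for i using that by (simp add: q'_def)
  have lt: "q i < p" if "i \<in> {1..k}" for i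
  proof -
    have "q i \<le> (\<Sum>i = 1..k. q i)" using that by (intro member_le_sum) auto
    then show ?thesis using p(1) by (simp add: Q_def)
  qed
  have ran: "{1..Suc k} = insert (Suc k) {1..k}" by auto
  have qp: "coprime (q i) p" if "i \<in> {1..k}" for i
  proof -
    have "q i dvd m" unfolding m_def using that by (intro dvd_prodI) auto
    then show ?thesis using p(2) by (meson coprime_commute coprime_divisors dvd_refl)
  qed
  have adm': "admissible K N (Suc k) q'"
    unfolding admissible_def
  proof (intro conjI)
    show "\<forall>i\<in>{1..Suc k}. q' i > N \<and> coprime (q' i) (fact K)"
      using adm p by (auto simp: ran q'_def admissible_def Q_def)
    show "strict_mono_on {1..Suc k} q'"
    proof (rule strict_mono_onI)
      fix i j assume "i \<in> {1..Suc k}" "j \<in> {1..Suc k}" "i < j"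
      then show "q' i < q' j"
        using adm lt by (cases "j = Suc k") (auto simp: q'_def admissible_def strict_mono_on_def)
    qed
    show "\<forall>i\<in>{1..Suc k}. \<forall>j\<in>{1..Suc k}. i \<noteq> j \<longrightarrow> coprime (q' i) (q' j)"
      using adm qp by (auto simp: ran q'_def admissible_def coprime_commute)
  qed
  have img: "q' ` {1..Suc k} = insert p (q ` {1..k})"
    unfolding ran using q'_le by (auto simp: q'_def)
  have m': "(\<Prod>i = 1..Suc k. q' i) = m * p"
  proof -
    have "(\<Prod>i = 1..k. q' i) = m" unfolding m_def using q'_le by (intro prod.cong) auto
    then show ?thesis by (simp add: q'_def)
  qed
  define G where "G = cpoly (incl_excl_poly (q' ` {1..Suc k}))"
  have "incl_excl_poly (insert p (q ` {1..k})) * incl_excl_poly (q ` {1..k})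
      = incl_excl_poly (q ` {1..k}) \<circ>\<^sub>p monom 1 p"
  proof (rule incl_excl_poly_insert)
    show "pairwise coprime (q ` {1..k})" by (rule admissible_props[OF adm])
    show "p \<notin> q ` {1..k}" using lt by (metis imageE less_irrefl)
    show "coprime p (\<Prod>(q ` {1..k}))" using p(2) unfolding admissible_props(4)[OF adm] m_def .
    show "r > 0" if "r \<in> insert p (q ` {1..k})" for r using that pos p(1) by auto
  qed simp
  then have "poly G x * poly F x = poly F (x ^ p)" for x
    unfolding G_def F_def img by (metis cpoly_mult poly_cpoly_pcompose_monom poly_mult)
  note G = T[OF this]
  define X' where "X' = coeff_scale (Suc k) q'"
  have pos': "q' i > 0" if "i \<in> {1..Suc k}" for i using admissible_props(1)[OF adm' that] .
  have X'_le: "X' \<le> X * (X * real P) / (8 * (real k + 1))"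
  proof -
    have "coeff_scale k q' = X" using M_rho_cong[of k q' q] q'_le by (simp add: coeff_scale_def X_def)
    moreover have "(\<Prod>i = 1..k - 1. q' i) = P"
      unfolding P_def using q'_le by (intro prod.cong) auto
    ultimately show ?thesis
      using coeff_scale_Suc_le[of k q'] by (simp add: X'_def power2_eq_square mult.assoc)
  qed
  have "X' > 0" unfolding X'_def using pos' by (rule coeff_scale_pos)
  have "extremal (Suc k) q' z' a' y'"
    unfolding extremal_def Let_def m' G_def[symmetric] X'_def[symmetric]
  proof (intro conjI)
    show "coprime z' (int (m * p))" by fact
    show "\<bar>real (m * p) * y' - of_int a'\<bar> < real (Suc k) + 1" using a'(3) by (simp add: add_ac)
    show "poly G (unit_pt (of_int z' / real (m * p))) = 0" using G by blast
    show "\<forall>i\<in>{1..Suc k}. [a' = int (Suc k - i + 1)] (mod int (q' i))"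
    proof
      fix i assume i: "i \<in> {1..Suc k}"
      show "[a' = int (Suc k - i + 1)] (mod int (q' i))"
      proof (cases "i = Suc k")
        case True
        then show ?thesis using a'(2) by (simp add: q'_def)
      next
        case False
        then have i: "i \<in> {1..k}" using i by auto
        have "q i dvd m" unfolding m_def using i by (intro dvd_prodI) auto
        then have "[a' = a + 1] (mod int (q i))" using a'(1) by (auto intro: cong_dvd_modulus)
        also have "[a + 1 = int (k - i + 1) + 1] (mod int (q i))"
          using a[OF i] by (intro cong_add cong_refl)
        also have "int (k - i + 1) + 1 = int (Suc k - i + 1)" using i by auto
        finally show ?thesis using q'_le[OF i] by simp
      qed
    qed
    have "(\<Prod>i = 1..Suc k - 1. q' i) = m"
      unfolding m_def using q'_le by (intro prod.cong) auto
    moreover have "real p / ((X * real P) * X) \<le> real (m * p) / (X' * real m)"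
    proof -
      \<comment> \<open>The new derivative bound carries no loss \<open>8 * (real k + 1)\<close>. As
        that loss is at least 1, the weaker bound with the smaller scale \<open>X'\<close>
        follows.\<close>
      have "1 * (X * (X * real P)) \<le> (8 * (real k + 1)) * (X * (X * real P))"
        using \<open>X > 0\<close> XP by (intro mult_right_mono) auto
      then have "X * (X * real P) / (8 * (real k + 1)) \<le> X * (X * real P)"
        by (simp add: divide_le_eq mult.commute)
      with X'_le have le: "X' \<le> X * real P * X" by (simp add: mult_ac)
      have "real p / ((X * real P) * X) \<le> real p / X'"
        using le \<open>X' > 0\<close> by (intro divide_left_mono) (auto simp: \<open>X > 0\<close> \<open>P > 0\<close>)
      also have "\<dots> = real (m * p) / (X' * real m)" using \<open>m > 0\<close> by simp
      finally show ?thesis .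
    qed
    ultimately show "cmod (poly (pderiv G) (unit_pt (of_int z' / real (m * p))))
        \<le> real (m * p) / (X' * real (\<Prod>i = 1..Suc k - 1. q' i))"
      using G by (metis order_trans)
    have "X' * real (m * p) \<le> X * (X * real P) / (8 * (real k + 1)) * real (m * p)"
      using X'_le by (intro mult_right_mono) auto
    with G show "X' * real (m * p) < cmod (poly G (unit_pt y'))" by linarith
  qed
  with adm' show ?thesis by (rule that)
qed

lemma exists_extremal:
  "k \<le> K \<Longrightarrow> \<exists>q z a y. admissible K N k q \<and> extremal k q z a y"
proof (induction k)
  case 0
  have "admissible K N 0 id" by (simp add: admissible_def)
  then show ?case using extremal_empty by blast
next
  case (Suc k)
  then show ?case by (meson Suc_leD Suc_le_lessD extremal_Suc)
qed

section \<open>From a large value to a large coefficient\<close>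

text \<open>At most \<open>m + 1 \<le> 2 * m\<close> coefficients contribute to a value of modulus
  above \<open>coeff_scale k q * m\<close>, so one of them exceeds half the scale.\<close>

lemma coeff_scale_less_height:
  assumes adm: "admissible K N k q" and ext: "extremal k q z a y"
  shows "coeff_scale k q < 2 * of_int (incl_excl_height (q ` {1..k}))"
proof -
  define m where "m = (\<Prod>i = 1..k. q i)"
  define p where "p = incl_excl_poly (q ` {1..k})"
  define H where "H = real_of_int (poly_height p)"
  have "m > 0" unfolding m_def using admissible_props(1)[OF adm] by (intro prod_pos) auto
  have "cyclotomic_like m p"
    unfolding p_def m_def admissible_props(4)[OF adm, symmetric]
    by (rule incl_excl_poly_cyclotomic_like) (use admissible_props[OF adm] in auto)
  then have deg: "degree p \<le> m" by (simp add: cyclotomic_like_def)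
  have "0 \<le> \<bar>coeff p 0\<bar>" by simp
  also have "\<dots> \<le> poly_height p" unfolding poly_height_def by (intro Max_ge) auto
  finally have "H \<ge> 0" by (simp add: H_def)
  have "coeff_scale k q * m < cmod (poly (cpoly p) (unit_pt y))"
    using ext by (simp add: extremal_def Let_def m_def p_def)
  also have "\<dots> \<le> (real (degree p) + 1) * H"
    unfolding H_def by (rule norm_poly_le_height) simp
  also have "\<dots> \<le> (2 * real m) * H"
    using deg \<open>m > 0\<close> \<open>H \<ge> 0\<close> by (intro mult_right_mono) auto
  finally have "coeff_scale k q * m < (2 * H) * m" by (simp add: mult_ac)
  then show ?thesis using \<open>m > 0\<close> by (simp add: H_def p_def incl_excl_height_def)
qed

theorem theorem2:
  "\<exists>(c::real) (\<epsilon> :: nat \<Rightarrow> real). c > 0 \<and> \<epsilon> \<longlonglongrightarrow> 0 \<and>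
     (\<forall>(k::nat) \<ge> 1. \<forall>(N::nat) \<ge> 1. \<exists>q :: nat \<Rightarrow> nat.
        (\<forall>j\<in>{1..k}. 0 < q j) \<and>
        strict_mono_on {1..k} q \<and>
        (\<forall>i\<in>{1..k}. \<forall>j\<in>{1..k}. i \<noteq> j \<longrightarrow> coprime (q i) (q j)) \<and>
        q 1 > N \<and>
        (real_of_int (incl_excl_height (q ` {1..k})) / real (M_rho k q)) powr (2 powr (- real k))
          > c + \<epsilon> k)"
proof (rule exI[of _ "1 / 16"], rule exI[of _ "\<lambda>_. 0"], intro conjI allI impI)
  show "(1 / 16 :: real) > 0" by simp
  show "(\<lambda>_. 0) \<longlonglongrightarrow> (0 :: real)" by simp
  fix k N :: nat assume "k \<ge> 1" "N \<ge> 1"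
  \<comment> \<open>The bound on the number of moduli is taken to be \<open>k\<close>
    itself.\<close>
  obtain q z a y where adm: "admissible k N k q" and ext: "extremal k q z a y"
    using exists_extremal[of k k N] by auto
  show "\<exists>q :: nat \<Rightarrow> nat.
        (\<forall>j\<in>{1..k}. 0 < q j) \<and>
        strict_mono_on {1..k} q \<and>
        (\<forall>i\<in>{1..k}. \<forall>j\<in>{1..k}. i \<noteq> j \<longrightarrow> coprime (q i) (q j)) \<and>
        q 1 > N \<and>
        (real_of_int (incl_excl_height (q ` {1..k})) / real (M_rho k q)) powr (2 powr (- real k))
          > 1 / 16 + 0"
  proof (intro exI[of _ q] conjI)
    show "\<forall>j\<in>{1..k}. 0 < q j" using admissible_props(1)[OF adm] by blast
    show "strict_mono_on {1..k} q" "\<forall>i\<in>{1..k}. \<forall>j\<in>{1..k}. i \<noteq> j \<longrightarrow> coprime (q i) (q j)"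
      "q 1 > N"
      using adm \<open>k \<ge> 1\<close> by (simp_all add: admissible_def)
    define r where "r = real_of_int (incl_excl_height (q ` {1..k})) / real (M_rho k q)"
    have M: "M_rho k q > 0" using admissible_props(1)[OF adm] by (rule M_rho_pos)
    have "4 * (real k + 2) * (1 / 16) ^ (2 ^ k) * M_rho k q < of_int (incl_excl_height (q ` {1..k}))"
      using coeff_scale_less_height[OF adm ext] unfolding coeff_scale_def by linarith
    then have "4 * (real k + 2) * (1 / 16) ^ (2 ^ k) < r"
      using M by (simp add: r_def pos_less_divide_eq)
    \<comment> \<open>The factor \<open>4 * (real k + 2)\<close> is at least 1 and is dropped; the
      constant 1/16 is thus reached with error term zero.\<close>
    moreover have "1 * (1 / 16) ^ (2 ^ k) \<le> 4 * (real k + 2) * (1 / 16 :: real) ^ (2 ^ k)"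
      by (intro mult_right_mono) auto
    ultimately have r: "(1 / 16) ^ (2 ^ k) < r" by linarith
    have "1 / 16 = ((1 / 16 :: real) powr (2 ^ k)) powr (2 powr (- real k))"
      by (simp add: powr_powr powr_minus powr_realpow)
    also have "(1 / 16 :: real) powr (2 ^ k) = (1 / 16) ^ (2 ^ k)"
      using powr_realpow[of "1 / 16 :: real" "2 ^ k"] by simp
    also have "((1 / 16) ^ (2 ^ k)) powr (2 powr (- real k)) < r powr (2 powr (- real k))"
      using r by (intro powr_less_mono2) auto
    finally show "r powr (2 powr (- real k)) > 1 / 16 + 0" by simp
  qed
qed

end
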